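(* Let $n\geq 10$ be an even integer, let $c\geq 0$ be a real number, and let $m$ be an integer with $m>4n\log n+cn$. After $m$ top to random shuffles of a deck of $n$ cards initially ordered $1$ (top) through $n$ (bottom), the best no feedback guessing strategy is to guess card $n-1$ for positions $1$ through $n/2$ and card $n$ for positions $n/2+1$ through $n$; that is, this strategy maximizes the expected number of correct guesses among all no feedback guessing strategies.
   Context: The deck consists of $n$ cards labeled $1,\dots,n$, initially ordered with card $1$ on top (position $1$) through card $n$ at the bottom (position $n$). One top to random shuffle removes the top card and reinserts it into the deck at a position chosen uniformly from $\{1,\dots,n\}$ (each with probability $1/n$); successive shuffles are independent. After $m$ shuffles the deck is placed face down and a guesser names a card for each position, starting from the top. The guesser receives no information during the process (neither whether a guess was correct nor what the card was). A no feedback guessing strategy is thus an assignment $g:\{1,\dots,n\}\to\{1,\dots,n\}$ of a guessed card $g(k)$ to each position $k$ (repeated guesses are allowed), and the number of correct guesses is the number of positions $k$ at which the card is $g(k)$. A best no feedback guessing strategy is one maximizing the expected number of correct guesses. $\log$ is the natural logarithm. *)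

theory Defs
  imports "HOL-Probability.Probability"
begin

text \<open>
  A deck is the list of its card labels from top to bottom, so the card at position
  \<open>k \<in> {1..n}\<close> of a deck \<open>d\<close> is \<open>d ! (k - 1)\<close>.
\<close>

definition initial_deck :: "nat \<Rightarrow> nat list" where
  "initial_deck n = [1..<n + 1]"

text \<open>After the move, the former top card occupies position \<open>j\<close> (for \<open>j\<close> from 1 to the deck size).\<close>

definition move_top :: "nat \<Rightarrow> nat list \<Rightarrow> nat list" where
  "move_top j d = take (j - 1) (tl d) @ [hd d] @ drop (j - 1) (tl d)"

definition top_to_random :: "nat \<Rightarrow> nat list \<Rightarrow> nat list pmf" where
  "top_to_random n d = map_pmf (\<lambda>j. move_top j d) (pmf_of_set {1..n})"

text \<open>
  Each step draws a fresh insertion position whatever the past, which expresses the independence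
  of successive shuffles.
\<close>

primrec deck_after :: "nat \<Rightarrow> nat \<Rightarrow> nat list pmf" where
  "deck_after n 0 = return_pmf (initial_deck n)"
| "deck_after n (Suc m) = bind_pmf (deck_after n m) (top_to_random n)"

definition no_feedback_strategies :: "nat \<Rightarrow> (nat \<Rightarrow> nat) set" where
  "no_feedback_strategies n = {1..n} \<rightarrow> {1..n}"

definition correct_guesses :: "nat \<Rightarrow> (nat \<Rightarrow> nat) \<Rightarrow> nat list \<Rightarrow> nat" where
  "correct_guesses n g d = card {k \<in> {1..n}. d ! (k - 1) = g k}"

definition expected_correct :: "nat \<Rightarrow> nat \<Rightarrow> (nat \<Rightarrow> nat) \<Rightarrow> real" where
  "expected_correct n m g =
     measure_pmf.expectation (deck_after n m) (\<lambda>d. real (correct_guesses n g d))"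

definition best_no_feedback_strategy :: "nat \<Rightarrow> nat \<Rightarrow> (nat \<Rightarrow> nat) \<Rightarrow> bool" where
  "best_no_feedback_strategy n m g \<longleftrightarrow>
     g \<in> no_feedback_strategies n \<and>
     (\<forall>h \<in> no_feedback_strategies n. expected_correct n m h \<le> expected_correct n m g)"

end

theory Submission
  imports Defs
begin

text \<open>
  The position of a single card is a Markov chain on \<open>{1..n}\<close> with eigenvalues \<open>1\<close> and
  \<open>(n - 1 - e) / n\<close> for \<open>1 \<le> e < n\<close>. Counting cards by \<open>a = n - i\<close> from the bottom of the initial
  deck, the right eigenvectors are the alternating binomial rows
  \<open>a \<mapsto> (-1)^(e + a) (e choose a)\<close>, and binomial inversion makes the spectral decomposition explicit.
  Beyond the constant \<open>1 / n\<close>, the term \<open>e = 1\<close> is supported on the cards \<open>n - 1\<close> and \<open>n\<close>,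
  where it has coefficient \<open>(n + 1 - 2 k) / 2\<close> and its negative at position \<open>k\<close>; for even \<open>n\<close> this
  is at least \<open>1 / 2\<close> in absolute value and changes sign at the middle of the deck. After
  \<open>4 n ln n\<close> shuffles the terms \<open>e \<ge> 2\<close> sum to at most a quarter of the leading eigenvalue power, so the sign of the leading term decides which card to guess.
\<close>

section \<open>Effect of one shuffle on positions\<close>

lemma length_move_top: "d \<noteq> [] \<Longrightarrow> length (move_top j d) = length d"
  by (cases d) (auto simp: move_top_def)

text \<open>Removing the top card lifts the rest by one position, and reinserting it at
  \<open>j\<close> lowers those from \<open>j\<close> on again; \<open>d ! k\<close> is the card at
  position \<open>k + 1\<close>.\<close>

lemma nth_move_top:
  assumes "length d = n" "k \<in> {1..n}" "j \<in> {1..n}"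
  shows "move_top j d ! (k - 1) = (if k < j then d ! k else if k = j then d ! 0 else d ! (k - 1))"
proof -
  obtain x xs where d: "d = x # xs"
    using assms by (cases d) auto
  obtain k' j' where "k = Suc k'" "j = Suc j'"
    using assms by (cases k; cases j) auto
  with assms d show ?thesis
    by (auto simp: move_top_def nth_append nth_Cons' min_def)
qed

lemma length_deck_after: "n \<ge> 1 \<Longrightarrow> d \<in> set_pmf (deck_after n m) \<Longrightarrow> length d = n"
proof (induction m arbitrary: d)
  case (Suc m)
  then obtain d' j where d': "d' \<in> set_pmf (deck_after n m)" "d = move_top j d'"
    by (auto simp: top_to_random_def)
  with Suc have "length d' = n" by blast
  then show ?case
    using d' Suc.prems(1) by (cases "d' = []") (auto simp: length_move_top)
qed (auto simp: initial_deck_def)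

lemma integrable_indicator_pmf: "integrable (measure_pmf p) (indicator A :: _ \<Rightarrow> real)"
  by (intro measure_pmf.integrable_const_bound[where B = 1]) auto

section \<open>Markov chain of a single card\<close>

definition card_prob :: "nat \<Rightarrow> nat \<Rightarrow> nat \<Rightarrow> nat \<Rightarrow> real" where
  "card_prob n m i k = measure_pmf.prob (deck_after n m) {d. d ! (k - 1) = i}"

lemma expectation_deck_after_Suc:
  fixes f :: "nat list \<Rightarrow> real"
  assumes "n \<ge> 1"
  shows "measure_pmf.expectation (deck_after n (Suc m)) f =
    measure_pmf.expectation (deck_after n m) (\<lambda>d. (\<Sum>j=1..n. f (move_top j d)) / n)"
proof -
  \<comment> \<open>Finite support turns the expectation of a bind into a finite sum for arbitrary
    \<open>f\<close>.\<close>
  have fin: "finite (set_pmf (deck_after n m))" for m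
    using assms by (induction m) (auto simp: top_to_random_def)
  show ?thesis
    using assms fin[of m]
    by (simp add: pmf_expectation_bind[where A = "set_pmf (deck_after n m)"]
        top_to_random_def integral_pmf_of_set integral_measure_pmf_real
        integral_measure_pmf[where A = "set_pmf (deck_after n m)"] sum_divide_distrib mult.commute)
qed

text \<open>Of the \<open>n\<close> insertion positions \<open>j\<close>, \<open>j = k\<close> puts
  the top card at \<open>k\<close>, the \<open>k - 1\<close> smaller ones leave the card there, and
  the \<open>n - k\<close> larger ones lift the card from \<open>k + 1\<close>. At
  \<open>k = n\<close> the out-of-range entry has weight 0.\<close>

lemma card_prob_Suc:
  assumes "k \<in> {1..n}"
  shows "card_prob n (Suc m) i k =
    (card_prob n m i 1 + (real k - 1) * card_prob n m i k
      + (real n - real k) * card_prob n m i (k + 1)) / n"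
proof -
  have n: "n \<ge> 1" using assms by auto
  have ind: "card_prob n m i k =
      measure_pmf.expectation (deck_after n m) (\<lambda>d. indicator {d. d ! (k - 1) = i} d)" for m k
    by (simp add: card_prob_def)
  let ?I = "\<lambda>k d. indicator {d. d ! (k - 1) = i} d :: real"
  have step: "(\<Sum>j=1..n. ?I k (move_top j d)) / n =
      (?I 1 d + (real k - 1) * ?I k d + (real n - real k) * ?I (k + 1) d) / n"
    if "d \<in> set_pmf (deck_after n m)" for d
  proof -
    have len: "length d = n" using length_deck_after n that by blast
    have split: "{1..n} = insert k ({1..<k} \<union> {k<..n})" using assms by auto
    have disj: "{1..<k} \<inter> {k<..n} = {}" by auto
    let ?F = "\<lambda>j. ?I k (move_top j d)"
    have F: "?F j = (if k < j then ?I (k + 1) d else if k = j then ?I 1 d else ?I k d)"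
      if "j \<in> {1..n}" for j
      using nth_move_top[OF len assms that] by (simp add: indicator_def)
    have "(\<Sum>j=1..n. ?F j) = (\<Sum>j\<in>{1..<k}. ?F j) + ?F k + (\<Sum>j\<in>{k<..n}. ?F j)"
      unfolding split by (simp add: sum.union_disjoint disj del: One_nat_def)
    also have "(\<Sum>j\<in>{1..<k}. ?F j) = (\<Sum>j\<in>{1..<k}. ?I k d)"
      by (intro sum.cong refl) (use F assms in fastforce)
    also have "(\<Sum>j\<in>{k<..n}. ?F j) = (\<Sum>j\<in>{k<..n}. ?I (k + 1) d)"
      by (intro sum.cong refl) (use F assms in fastforce)
    also have "?F k = ?I 1 d"
      using F[OF assms] by simp
    also have "(\<Sum>j\<in>{1..<k}. ?I k d) + ?I 1 d + (\<Sum>j\<in>{k<..n}. ?I (k + 1) d)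
        = ?I 1 d + (real k - 1) * ?I k d + (real n - real k) * ?I (k + 1) d"
      using assms by (simp add: of_nat_diff)
    finally show ?thesis by simp
  qed
  \<comment> \<open>Indexing relies on \<open>length d = n\<close>, so the identity is claimed only
    on the support.\<close>
  have "AE d in deck_after n m. (\<Sum>j=1..n. ?I k (move_top j d)) / n =
      (?I 1 d + (real k - 1) * ?I k d + (real n - real k) * ?I (k + 1) d) / n"
    unfolding AE_measure_pmf_iff by (intro ballI step)
  then have "card_prob n (Suc m) i k = measure_pmf.expectation (deck_after n m)
      (\<lambda>d. (?I 1 d + (real k - 1) * ?I k d + (real n - real k) * ?I (k + 1) d) / n)"
    unfolding ind expectation_deck_after_Suc[OF n]
    by (rule integral_cong_AE[rotated 2]) simp_all
  also have "\<dots> = (card_prob n m i 1 + (real k - 1) * card_prob n m i k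
      + (real n - real k) * card_prob n m i (k + 1)) / n"
    unfolding ind by (simp add: integrable_indicator_pmf)
  finally show ?thesis .
qed

text \<open>Linearity of expectation lets a strategy be optimised separately at each
  position.\<close>

lemma expected_correct_eq:
  "expected_correct n m g = (\<Sum>k=1..n. card_prob n m (g k) k)"
proof -
  have "real (correct_guesses n g d) = (\<Sum>k=1..n. indicator {d. d ! (k - 1) = g k} d)" for d
  proof -
    have "real (correct_guesses n g d) = (\<Sum>k | k \<in> {1..n} \<and> d ! (k - 1) = g k. 1)"
      by (simp add: correct_guesses_def)
    also have "\<dots> = (\<Sum>k=1..n. if d ! (k - 1) = g k then 1 else 0)"
      by (rule sum.inter_filter) simp
    finally show ?thesis by (simp only: indicator_def mem_Collect_eq of_bool_def)
  qed
  then have "expected_correct n m g = measure_pmf.expectation (deck_after n m)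
      (\<lambda>d. \<Sum>k=1..n. indicator {d. d ! (k - 1) = g k} d)"
    by (simp only: expected_correct_def)
  also have "\<dots> = (\<Sum>k=1..n. card_prob n m (g k) k)"
    by (subst Bochner_Integration.integral_sum)
      (simp_all add: card_prob_def integrable_indicator_pmf del: One_nat_def)
  finally show ?thesis .
qed

section \<open>Binomial inversion\<close>

text \<open>Trinomial revision factors out \<open>N choose a\<close> and leaves the alternating row
  sum of \<open>N - a\<close>, which is 0 unless \<open>a = N\<close>.\<close>

lemma alternating_binomial_orthogonality:
  assumes "N < n"
  shows "(\<Sum>e<n. (-1) ^ (e + a) * real (e choose a) * real (N choose e)) = (if a = N then 1 else 0)"
proof (cases "a \<le> N")
  case True
  have "(\<Sum>e<n. (-1) ^ (e + a) * real (e choose a) * real (N choose e)) =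
      (\<Sum>e=a..N. (-1) ^ (e + a) * real (e choose a) * real (N choose e))"
    using assms by (intro sum.mono_neutral_right) auto
  also have "\<dots> = (\<Sum>e=a..N. real (N choose a) * ((-1) ^ (e - a) * real ((N - a) choose (e - a))))"
  proof (intro sum.cong refl)
    fix e assume e: "e \<in> {a..N}"
    then have "(N choose e) * (e choose a) = (N choose a) * ((N - a) choose (e - a))"
      using choose_mult by auto
    moreover have "(-1::real) ^ (e + a) = (-1) ^ (e - a)"
      using e by (simp add: minus_one_power_iff)
    ultimately show "(-1) ^ (e + a) * real (e choose a) * real (N choose e) =
        real (N choose a) * ((-1) ^ (e - a) * real ((N - a) choose (e - a)))"
      by (simp add: mult.assoc mult.left_commute flip: of_nat_mult) (simp add: mult.commute)
  qed
  also have "\<dots> = real (N choose a) * (\<Sum>e\<le>N - a. (-1) ^ e * real ((N - a) choose e))"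
    using True sum.shift_bounds_cl_nat_ivl[of "\<lambda>e. (-1) ^ (e - a) * real ((N - a) choose (e - a))" 0 a "N - a"]
    by (simp add: sum_distrib_left[symmetric] atLeast0AtMost)
  also have "\<dots> = (if a = N then 1 else 0)"
    using choose_alternating_sum[of "N - a", where ?'a = real] True by auto
  finally show ?thesis .
next
  case False
  then show ?thesis
    by (auto intro!: sum.neutral simp: binomial_eq_0_iff)
qed

text \<open>Since \<open>n choose (e + 1)\<close> is the sum of \<open>N choose e\<close> over
  \<open>N < n\<close>, swapping sums leaves orthogonality sums, of which only \<open>N = a\<close>
  contributes.\<close>

lemma alternating_binomial_hockey_stick:
  assumes "a < n"
  shows "(\<Sum>e<n. (-1) ^ (e + a) * real (e choose a) * real (n choose (e + 1))) = 1"
proof -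
  have "real (n choose (e + 1)) = (\<Sum>N<n. real (N choose e))" for e
  proof -
    have "(\<Sum>N<n. N choose e) = n choose (e + 1)"
      by (induction n) auto
    then show ?thesis by (metis of_nat_sum)
  qed
  then have "(\<Sum>e<n. (-1) ^ (e + a) * real (e choose a) * real (n choose (e + 1))) =
      (\<Sum>N<n. \<Sum>e<n. (-1) ^ (e + a) * real (e choose a) * real (N choose e))"
    by (subst sum.swap) (simp add: sum_distrib_left)
  also have "\<dots> = (\<Sum>N<n. if a = N then 1 else 0)"
    by (intro sum.cong refl alternating_binomial_orthogonality) auto
  finally show ?thesis using assms by simp
qed

section \<open>Eigenvectors of the position chain\<close>

text \<open>
  For \<open>e \<ge> 1\<close> these are the left eigenvectors for the eigenvalue \<open>(n - 1 - e) / n\<close>; for \<open>e = 0\<close> the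
  function vanishes, because the constant eigenvector is split off separately.
\<close>

definition left_eigenvector :: "nat \<Rightarrow> nat \<Rightarrow> nat \<Rightarrow> real" where
  "left_eigenvector n e k = real ((n - k) choose e) - real (n choose (e + 1)) / n"

lemma left_eigenvector_0: "n \<ge> 1 \<Longrightarrow> left_eigenvector n 0 k = 0"
  by (simp add: left_eigenvector_def)

lemma left_eigenvector_1:
  assumes "n \<ge> 1" "k \<le> n"
  shows "left_eigenvector n 1 k = (real n + 1 - 2 * real k) / 2"
proof -
  have "real (n choose 2) = real n * (real n - 1) / 2"
    using assms by (simp add: choose_two real_of_nat_div of_nat_diff)
  then show ?thesis
    using assms by (simp add: left_eigenvector_def of_nat_diff field_simps numeral_2_eq_2)
qed

lemma real_choose_absorb:
  "real n * real ((n - 1) choose e) = (real e + 1) * real (n choose (e + 1))"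
proof (cases n)
  case (Suc n')
  then show ?thesis
    using Suc_times_binomial_eq[of n' e]
    by (metis Suc_eq_plus1 diff_Suc_1 mult.commute of_nat_Suc of_nat_mult add.commute)
qed auto

text \<open>The subtracted term is the mean of \<open>(n - k) choose e\<close> over all positions.
  By absorption it equals \<open>((n - 1) choose e) / (e + 1)\<close>, so both parts of the
  difference lie between 0 and \<open>(n - 1) choose e\<close>.\<close>

lemma abs_left_eigenvector_le:
  assumes "k \<in> {1..n}"
  shows "\<bar>left_eigenvector n e k\<bar> \<le> real ((n - 1) choose e)"
proof -
  have "real (n choose (e + 1)) / n = real ((n - 1) choose e) / (real e + 1)"
    using real_choose_absorb[of n e] assms by (simp add: field_simps)
  also have "\<dots> \<le> real ((n - 1) choose e)"
    by (simp add: divide_le_eq mult_le_cancel_left1)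
  finally have "real (n choose (e + 1)) / n \<le> real ((n - 1) choose e)" .
  moreover have "(n - k) choose e \<le> (n - 1) choose e"
    using assms by (intro binomial_right_mono) auto
  moreover have "0 \<le> real (n choose (e + 1)) / n" by simp
  ultimately show ?thesis
    unfolding left_eigenvector_def by linarith
qed

text \<open>By absorption the binomials at \<open>k\<close> and \<open>k + 1\<close> combine to the
  eigenvalue numerator times \<open>(n - k) choose e\<close>. Position 1 adds
  \<open>(e + 1) * x\<close>, while the constant \<open>x\<close> is subtracted with total weight
  \<open>n\<close>; the rest \<open>(e + 1 - n) * x\<close> is the numerator times
  \<open>-x\<close>.\<close>

lemma left_eigenvector_step:
  assumes "k \<in> {1..n}"
  shows "left_eigenvector n e 1 + (real k - 1) * left_eigenvector n e k
      + (real n - real k) * left_eigenvector n e (k + 1)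
    = (real n - 1 - real e) * left_eigenvector n e k"
proof -
  define x where "x = real (n choose (e + 1)) / n"
  have x: "(real e + 1) * x = real ((n - 1) choose e)"
    using real_choose_absorb[of n e] assms unfolding x_def by (simp add: field_simps)
  have "(real n - real k) * real ((n - (k + 1)) choose e)
      = (real n - real k - real e) * real ((n - k) choose e)"
  \<comment> \<open>The natural number \<open>n - k - e\<close> is truncated for
    \<open>e > n - k\<close>, but then both binomials vanish.\<close>
  proof (cases "e \<le> n - k")
    case True
    have "(n - k - e) * ((n - k) choose e) = (n - k) * ((n - k - 1) choose e)"
      by (rule binomial_absorb_comp)
    then have absorb: "real (n - k - e) * real ((n - k) choose e)
        = real (n - k) * real ((n - (k + 1)) choose e)"
      by (metis of_nat_mult diff_diff_left)
    have "real (n - k - e) = real n - real k - real e" "real (n - k) = real n - real k"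
      using True assms by auto
    with absorb show ?thesis by (simp only:)
  next
    case False
    then show ?thesis by (simp add: binomial_eq_0)
  qed
  with x show ?thesis
    unfolding left_eigenvector_def x_def[symmetric] by (simp add: algebra_simps)
qed

section \<open>Spectral decomposition\<close>

text \<open>At \<open>m = 0\<close> all powers are 1 (also \<open>0 ^ 0\<close> for
  \<open>e = n - 1\<close>), and the two binomial sums leave the indicator of
  \<open>k = n - a\<close>. Each shuffle then multiplies the term \<open>e\<close> by its
  eigenvalue.\<close>

lemma card_prob_spectral:
  assumes "a < n" "k \<in> {1..n}"
  shows "card_prob n m (n - a) k = 1 / n +
    (\<Sum>e<n. ((real n - 1 - real e) / n) ^ m * ((-1) ^ (e + a) * real (e choose a))
       * left_eigenvector n e k)"
  using assms(2)
proof (induction m arbitrary: k)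
  case 0
  let ?w = "\<lambda>e. (-1) ^ (e + a) * real (e choose a)"
  have "(\<Sum>e<n. ?w e * left_eigenvector n e k) =
      (\<Sum>e<n. ?w e * real ((n - k) choose e)) - (\<Sum>e<n. ?w e * real (n choose (e + 1))) / n"
    by (simp add: left_eigenvector_def right_diff_distrib sum_subtractf sum_divide_distrib)
  also have "\<dots> = (if a = n - k then 1 else 0) - 1 / n"
    using 0 alternating_binomial_orthogonality[of "n - k" n a]
      alternating_binomial_hockey_stick[OF assms(1)] by simp
  finally show ?case
    using 0 assms(1) by (auto simp: card_prob_def initial_deck_def measure_return_pmf indicator_def
        nth_append simp del: upt_Suc)
next
  case (Suc m)
  let ?c = "\<lambda>e. ((real n - 1 - real e) / n) ^ m * ((-1) ^ (e + a) * real (e choose a))"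
  let ?v = "left_eigenvector n"
  have n: "n \<ge> 1" using assms by simp
  \<comment> \<open>For \<open>k = n\<close> the induction hypothesis does not cover
    \<open>k + 1\<close>, but the factor is 0.\<close>
  have next_pos: "(real n - real k) * card_prob n m (n - a) (k + 1) =
      (real n - real k) * (1 / n + (\<Sum>e<n. ?c e * ?v e (k + 1)))"
    using Suc by (cases "k = n") auto
  have "card_prob n (Suc m) (n - a) k =
    ((1 / n + (\<Sum>e<n. ?c e * ?v e 1)) + (real k - 1) * (1 / n + (\<Sum>e<n. ?c e * ?v e k))
      + (real n - real k) * (1 / n + (\<Sum>e<n. ?c e * ?v e (k + 1)))) / n"
    unfolding card_prob_Suc[OF Suc.prems] next_pos using Suc n by simp
  also have "\<dots> = (1 + (\<Sum>e<n. ?c e * (?v e 1 + (real k - 1) * ?v e k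
      + (real n - real k) * ?v e (k + 1)))) / n"
  proof -
    \<comment> \<open>The weights \<open>1\<close>, \<open>K - 1\<close>, \<open>N - K\<close> sum
      to \<open>N\<close>, which preserves the constant \<open>1 / N\<close>.\<close>
    have "((1 / N + A) + (K - 1) * (1 / N + B) + (N - K) * (1 / N + C)) / N
        = (1 + (A + (K - 1) * B + (N - K) * C)) / N" if "N > 0" for A B C K N :: real
      using that by (simp add: field_simps)
    moreover have "(\<Sum>e<n. ?c e * (?v e 1 + (real k - 1) * ?v e k
        + (real n - real k) * ?v e (k + 1)))
      = (\<Sum>e<n. ?c e * ?v e 1) + (real k - 1) * (\<Sum>e<n. ?c e * ?v e k)
        + (real n - real k) * (\<Sum>e<n. ?c e * ?v e (k + 1))"
      by (simp only: distrib_left sum.distrib sum_distrib_left mult.left_commute)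
    ultimately show ?thesis using n by simp
  qed
  also have "\<dots> = (1 + (\<Sum>e<n. ?c e * ((real n - 1 - real e) * ?v e k))) / n"
    by (simp only: left_eigenvector_step[OF Suc.prems])
  also have "\<dots> = 1 / n + (\<Sum>e<n. (real n - 1 - real e) / n * ?c e * ?v e k)"
    by (simp add: add_divide_distrib sum_divide_distrib mult_ac)
  finally show ?case by (simp only: power_Suc mult.assoc)
qed

section \<open>Decay of the higher terms\<close>

text \<open>With \<open>s = e - 1\<close> the eigenvalue is at most
  \<open>(n - 2) / n * (1 - s / n)\<close>, and \<open>1 - s / n \<le> exp (- (s / n))\<close>. As
  \<open>m / n \<ge> 4 * ln n\<close>, the power \<open>m\<close> of the exponential is at most
  \<open>1 / n ^ (4 * s)\<close>.\<close>

lemma eigenvalue_power_ratio: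
  assumes n: "n \<ge> 2" and e: "1 \<le> e" "e < n" and m: "real m \<ge> 4 * real n * ln (real n)"
  shows "((real n - 1 - real e) / n) ^ m \<le> ((real n - 2) / n) ^ m / real n ^ (4 * (e - 1))"
proof -
  define s where "s = real (e - 1)"
  have s: "real e = s + 1" "s \<ge> 0" using e by (auto simp: s_def)
  have "(real n - 1 - real e) / n \<le> (real n - 2) / n * (1 - s / n)"
    using n s by (simp add: field_simps)
  also have "\<dots> \<le> (real n - 2) / n * exp (- (s / n))"
    using exp_ge_add_one_self[of "- (s / n)"] n by (intro mult_left_mono) auto
  finally have "((real n - 1 - real e) / n) ^ m \<le> ((real n - 2) / n * exp (- (s / n))) ^ m"
    using e by (intro power_mono) auto
  also have "\<dots> = ((real n - 2) / n) ^ m * exp (- (s * (m / n)))"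
  proof -
    have "exp (- (s / n)) ^ m = exp (- (s * (m / n)))"
      by (subst exp_of_nat_mult[symmetric]) simp
    then show ?thesis by (simp only: power_mult_distrib)
  qed
  also have "\<dots> \<le> ((real n - 2) / n) ^ m * exp (- (s * (4 * ln n)))"
    using n m s by (intro mult_left_mono) (auto simp: field_simps intro!: mult_left_mono)
  also have "exp (- (s * (4 * ln n))) = 1 / real n ^ (4 * (e - 1))"
  proof -
    have "real n ^ (4 * (e - 1)) = exp (real (4 * (e - 1)) * ln n)"
      using n by (subst exp_of_nat_mult) simp
    then show ?thesis by (simp add: s_def exp_minus field_simps)
  qed
  finally show ?thesis by simp
qed

lemma card_prob_approx:
  assumes n: "n \<ge> 10" and a: "a < n" and k: "k \<in> {1..n}"
    and m: "real m \<ge> 4 * real n * ln (real n)"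
  shows "\<bar>card_prob n m (n - a) k - (1 / n + ((real n - 2) / n) ^ m
      * ((-1) ^ (1 + a) * real (1 choose a)) * left_eigenvector n 1 k)\<bar>
    \<le> ((real n - 2) / n) ^ m / 4"
proof -
  define q where "q = ((real n - 2) / n) ^ m"
  have q: "q \<ge> 0" using n by (simp add: q_def)
  let ?t = "\<lambda>e. ((real n - 1 - real e) / n) ^ m * ((-1) ^ (e + a) * real (e choose a))
       * left_eigenvector n e k"
  have term_le: "\<bar>?t e\<bar> \<le> q * (1 / 2) ^ (e + 1)" if e: "e \<in> {2..<n}" for e
  proof -
    obtain f where f: "e = Suc (Suc f)" using e by (metis atLeastLessThan_iff add_2_eq_Suc le_Suc_ex)
    have coeff: "real (e choose a) * \<bar>left_eigenvector n e k\<bar> \<le> 2 ^ e * real n ^ e"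
    proof (intro mult_mono)
      show "real (e choose a) \<le> 2 ^ e"
        by (metis binomial_le_pow2 of_nat_le_iff of_nat_numeral of_nat_power)
      have "(n - 1) choose e \<le> (n - 1) ^ e"
        using e by (intro binomial_le_pow) auto
      also have "\<dots> \<le> n ^ e"
        by (intro power_mono) auto
      finally have "real ((n - 1) choose e) \<le> real n ^ e"
        by (metis of_nat_le_iff of_nat_power)
      with abs_left_eigenvector_le[OF k, of e] show "\<bar>left_eigenvector n e k\<bar> \<le> real n ^ e"
        by linarith
    qed auto
    define r where "r = ((real n - 1 - real e) / n) ^ m"
    have r_le: "r \<le> q / real n ^ (4 * (e - 1))"
      unfolding q_def r_def using e n m by (intro eigenvalue_power_ratio) auto
    have r: "r \<ge> 0"
      using e by (simp add: r_def)
    have "r * (real (e choose a) * \<bar>left_eigenvector n e k\<bar>)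
        \<le> q / real n ^ (4 * (e - 1)) * (2 ^ e * real n ^ e)"
      by (rule mult_mono[OF r_le coeff]) (use q in auto)
    also have "r * (real (e choose a) * \<bar>left_eigenvector n e k\<bar>) = \<bar>?t e\<bar>"
      using r unfolding r_def[symmetric] by (simp add: abs_mult power_abs)
    finally have "\<bar>?t e\<bar> \<le> q / real n ^ (4 * (e - 1)) * (2 ^ e * real n ^ e)" .
    also have "\<dots> \<le> q * (1 / 2) ^ (e + 1)"
    proof -
      \<comment> \<open>The coefficient bound \<open>2 ^ e * n ^ e\<close> times the target's
        \<open>2 ^ (e + 1)\<close> is the left side. At \<open>e = 2\<close> the claim is
        \<open>32 * n ^ 2 \<le> n ^ 4\<close>; each further \<open>e\<close> multiplies the left by
        \<open>4 * n\<close> and the right by \<open>n ^ 4\<close>.\<close>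
      have "2 * (4 * real n) ^ e \<le> real n ^ (4 * (e - 1))"
      proof -
        have "10 * 10 \<le> real n * real n" using n by (intro mult_mono) auto
        then have "32 \<le> real n ^ 2" by (simp add: power2_eq_square)
        then have "32 * real n ^ 2 \<le> real n ^ 2 * real n ^ 2"
          by (intro mult_right_mono) auto
        then have 1: "32 * real n ^ 2 \<le> real n ^ 4" by (simp flip: power_add)
        have "4 * real n \<le> 32 * real n ^ 2" using n by (simp add: power2_eq_square)
        then have "(4 * real n) ^ f \<le> (real n ^ 4) ^ f"
          using 1 by (intro power_mono) auto
        then have "32 * real n ^ 2 * (4 * real n) ^ f \<le> real n ^ 4 * (real n ^ 4) ^ f"
          using 1 by (intro mult_mono) auto
        moreover have "real n ^ (4 * (e - 1)) = real n ^ 4 * (real n ^ 4) ^ f"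
          by (simp add: f flip: power_mult power_add)
        moreover have "2 * (4 * real n) ^ e = 32 * real n ^ 2 * (4 * real n) ^ f"
          by (simp add: f power2_eq_square)
        ultimately show ?thesis by (simp only:)
      qed
      moreover have "(4 * real n) ^ e = 2 ^ e * (2 ^ e * real n ^ e)"
        by (simp only: power_mult_distrib[symmetric]) simp
      ultimately have "2 ^ e * real n ^ e / real n ^ (4 * (e - 1)) \<le> (1 / 2) ^ (e + 1)"
        using n by (simp add: field_simps power_divide)
      then have "q * (2 ^ e * real n ^ e / real n ^ (4 * (e - 1))) \<le> q * (1 / 2) ^ (e + 1)"
        using q by (rule mult_left_mono)
      then show ?thesis by (simp add: mult_ac)
    qed
    finally show ?thesis .
  qed
  have "(\<Sum>e\<in>{2..<N}. (1 / 2 :: real) ^ (e + 1)) = 1 / 4 - (1 / 2) ^ N" if "N \<ge> 2" for N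
    using that by (induction N rule: dec_induct) (auto simp: power2_eq_square)
  then have geo: "(\<Sum>e\<in>{2..<n}. (1 / 2 :: real) ^ (e + 1)) \<le> 1 / 4"
    using n by simp
  have "{..<n} = insert 0 (insert 1 {2..<n})" using n by auto
  then have "(\<Sum>e<n. ?t e) = ?t 1 + (\<Sum>e\<in>{2..<n}. ?t e)"
    using n by (simp add: left_eigenvector_0)
  then have "card_prob n m (n - a) k - (1 / n + ?t 1) = (\<Sum>e\<in>{2..<n}. ?t e)"
    by (simp only: card_prob_spectral[OF a k])
  also have "\<bar>\<dots>\<bar> \<le> (\<Sum>e\<in>{2..<n}. q * (1 / 2) ^ (e + 1))"
    by (intro order_trans[OF sum_abs] sum_mono term_le)
  also have "\<dots> \<le> q / 4"
    using mult_left_mono[OF geo q] by (simp add: sum_distrib_left)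
  finally show ?thesis by (simp add: q_def)
qed

section \<open>Comparing the cards at each position\<close>

theorem theorem3p13:
  fixes n m :: nat and c :: real
  assumes "n \<ge> 10" and "even n" and "c \<ge> 0"
    and "real m > 4 * real n * ln (real n) + c * real n"
  shows "best_no_feedback_strategy n m (\<lambda>k. if k \<le> n div 2 then n - 1 else n)"
proof -
  have m: "real m \<ge> 4 * real n * ln (real n)"
    using assms(3,4) mult_nonneg_nonneg[of c "real n"] by linarith
  define q where "q = ((real n - 2) / n) ^ m"
  have q: "q \<ge> 0" using assms(1) by (simp add: q_def)
  have best: "card_prob n m i k \<le> card_prob n m (if k \<le> n div 2 then n - 1 else n) k"
    if k: "k \<in> {1..n}" and i: "i \<in> {1..n}" for i k
  proof -
    define v where "v = q * left_eigenvector n 1 k"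
    have v: "left_eigenvector n 1 k = (real n + 1 - 2 * real k) / 2"
      using left_eigenvector_1 assms(1) k by simp
    \<comment> \<open>The signed factor \<open>1 choose a\<close> is -1 for card \<open>n\<close>, 1
      for card \<open>n - 1\<close>, and 0 for every other card.\<close>
    have approx: "\<bar>card_prob n m (n - a) k - (1 / n + (-1) ^ (1 + a) * real (1 choose a) * v)\<bar> \<le> q / 4"
      if "a < n" for a
      using card_prob_approx[OF assms(1) that k m] by (simp add: q_def v_def mult_ac)
    have A0: "\<bar>card_prob n m n k - (1 / n - v)\<bar> \<le> q / 4"
      using approx[of 0] assms(1) by simp
    have A1: "\<bar>card_prob n m (n - 1) k - (1 / n + v)\<bar> \<le> q / 4"
      using approx[of 1] assms(1) by simp
    have cases: "i = n \<or> i = n - 1 \<or> \<bar>card_prob n m i k - 1 / n\<bar> \<le> q / 4"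
    proof (cases "i = n \<or> i = n - 1")
      case False
      then have "n - i > 1" using i by auto
      then show ?thesis using approx[of "n - i"] i by (simp add: binomial_eq_0)
    qed blast
    obtain h where h: "n = 2 * h" using assms(2) by blast
    show ?thesis
    proof (cases "k \<le> n div 2")
      case True
      \<comment> \<open>Here \<open>n + 1 - 2 * k \<ge> 1\<close>. So card \<open>n - 1\<close> has
        probability at least \<open>1 / n + q / 4\<close>, which bounds all other cards from
        above.\<close>
      then have "1 / 2 \<le> left_eigenvector n 1 k" unfolding v using h by simp
      then have "q / 2 \<le> v" unfolding v_def using mult_left_mono[OF _ q] by fastforce
      with cases A0 A1 q have "card_prob n m i k \<le> card_prob n m (n - 1) k"
        by (elim disjE) (hypsubst, linarith, hypsubst, linarith, linarith)
      with True show ?thesis by simp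
    next
      case False
      \<comment> \<open>Evenness gives \<open>k \<ge> h + 1\<close>, hence
        \<open>n + 1 - 2 * k \<le> -1\<close>, and the two cards exchange roles.\<close>
      then have "left_eigenvector n 1 k \<le> - (1 / 2)" unfolding v using h by simp
      then have "v \<le> - (q / 2)" unfolding v_def using mult_left_mono[OF _ q] by fastforce
      with cases A0 A1 q have "card_prob n m i k \<le> card_prob n m (n) k"
        by (elim disjE) (hypsubst, linarith, hypsubst, linarith, linarith)
      with False show ?thesis by simp
    qed
  qed
  have "(\<lambda>k. if k \<le> n div 2 then n - 1 else n) \<in> no_feedback_strategies n"
    using assms(1) by (auto simp: no_feedback_strategies_def)
  moreover have "expected_correct n m g
      \<le> expected_correct n m (\<lambda>k. if k \<le> n div 2 then n - 1 else n)"
    if "g \<in> no_feedback_strategies n" for g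
    unfolding expected_correct_eq
    using that by (intro sum_mono best) (auto simp: no_feedback_strategies_def)
  ultimately show ?thesis
    unfolding best_no_feedback_strategy_def by blast
qed

end
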